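(* Let $\lambda\leq\Omega$ be a limit ordinal and let $\mathfrak F'=(f_\eta)_{\eta<\lambda}$ be a sequence of functions with properties (1)–(3) of the context. If $(\eta'_n)_{n<\omega}$ is a strictly increasing sequence of ordinals $<\lambda$ with $\sup_{n<\omega}\eta'_n\neq\lambda$, then $\bigcap_{n<\omega}Vf_{\eta'_n}=\emptyset$.
   Context: $\Omega=\omega_1$. Each $f_\eta$ is a strictly increasing function from the positive integers $\{1,2,3,\dots\}$ to the positive integers; $Vf$ denotes the range of $f$, and $f^2=f\circ f$. For ordinals $\alpha<\beta<\lambda$, write $\alpha\to\beta$ if $Vf_\zeta\subseteq Vf_\alpha$ for all $\zeta$ with $\alpha<\zeta\leq\beta$. Properties, for all $\eta<\lambda$: (1) $f_0(x)=2^x$. (2) If $\eta=\eta'+1$ then $f_\eta=f_{\eta'}^2$. (3) If $\eta$ is a limit ordinal, then $\eta$ is assigned a strictly increasing sequence $(\eta_x)_{x<\omega}$ with supremum $\eta$, such that $\eta_x+1\to\eta_{x+1}$ for all $x<\omega$, and $f_\eta(x)=f_{\eta_x}(1)$ for all $x\geq1$. *)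

theory Defs
  imports "HOL-Library.Lub_Glb"
begin

text \<open>
  Ordinals are elements of an arbitrary type of class \<open>wellorder\<close>; the element \<open>\<Lambda>\<close>
  stands for the order type of its initial segment \<open>{..<\<Lambda>}\<close>, so that \<open>\<alpha> < \<Lambda>\<close> is
  the order of the type.
\<close>

definition ord_zero :: "'o::wellorder" where
  "ord_zero = (LEAST \<alpha>. True)"

text \<open>Only meaningful if \<open>\<alpha>\<close> is not the largest element of the type.\<close>

definition ord_succ :: "'o::wellorder \<Rightarrow> 'o" where
  "ord_succ \<alpha> = (LEAST \<beta>. \<alpha> < \<beta>)"

definition ord_limit :: "'o::wellorder \<Rightarrow> bool" where
  "ord_limit \<eta> \<longleftrightarrow> \<eta> \<noteq> ord_zero \<and> \<not> (\<exists>\<alpha><\<eta>. \<eta> = ord_succ \<alpha>)"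

definition segment_rel :: "'o::wellorder \<Rightarrow> 'o rel" where
  "segment_rel \<Lambda> = {(\<alpha>, \<beta>). \<alpha> \<le> \<beta> \<and> \<beta> < \<Lambda>}"

lemma Well_order_segment_rel: "Well_order (segment_rel \<Lambda>)"
proof -
  have F: "Field (segment_rel \<Lambda>) = {..<\<Lambda>}"
    by (auto simp: segment_rel_def Field_def)
  have "wf (segment_rel \<Lambda> - Id)"
    by (rule wf_subset[OF wf]) (auto simp: segment_rel_def)
  then show ?thesis
    unfolding well_order_on_def linear_order_on_def partial_order_on_def preorder_on_def F
    by (auto simp: segment_rel_def refl_on_def trans_def antisym_def total_on_def)
qed

text \<open>\<open>\<Omega> = \<omega>\<^sub>1\<close>, the least uncountable well-order.\<close>

abbreviation Omega_rel :: "nat set rel" where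
  "Omega_rel \<equiv> cardSuc natLeq"

definition le_Omega :: "'o::wellorder \<Rightarrow> bool" where
  "le_Omega \<Lambda> \<longleftrightarrow> (segment_rel \<Lambda>, Omega_rel) \<in> ordLeq"

text \<open>
  A function on the positive integers is the restriction to \<open>{1..}\<close> of a function on
  \<open>nat\<close>; its value at \<open>0\<close> is irrelevant.
\<close>

definition pos_increasing :: "(nat \<Rightarrow> nat) \<Rightarrow> bool" where
  "pos_increasing g \<longleftrightarrow> g ` {1..} \<subseteq> {1..} \<and> strict_mono_on {1..} g"

definition V :: "(nat \<Rightarrow> nat) \<Rightarrow> nat set" where
  "V g = g ` {1..}"

definition arrow :: "('o::wellorder \<Rightarrow> nat \<Rightarrow> nat) \<Rightarrow> 'o \<Rightarrow> 'o \<Rightarrow> 'o \<Rightarrow> bool" where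
  "arrow f \<Lambda> \<alpha> \<beta> \<longleftrightarrow>
     \<alpha> < \<beta> \<and> \<beta> < \<Lambda> \<and> (\<forall>\<zeta>. \<alpha> < \<zeta> \<and> \<zeta> \<le> \<beta> \<longrightarrow> V (f \<zeta>) \<subseteq> V (f \<alpha>))"

end

theory Submission
  imports Defs
begin

text \<open>
  Let \<open>\<mu>\<close> be the supremum of the sequence \<open>\<eta>'\<close>, a limit below \<open>\<Lambda>\<close>, with fundamental
  sequence \<open>\<mu>\<^sub>x\<close>. If \<open>\<mu>\<^sub>k < \<zeta> \<le> \<mu>\<^bsub>k+1\<^esub>\<close>, then \<open>V f\<^sub>\<zeta>\<close> is contained in the range of
  \<open>f\<^bsub>\<mu>\<^sub>k+1\<^esub> = f\<^bsub>\<mu>\<^sub>k\<^esub>\<^sup>2\<close>, so all its elements are at least \<open>f\<^bsub>\<mu>\<^sub>k\<^esub>(1) = f\<^sub>\<mu>(k) \<ge> k\<close>.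
  As \<open>\<eta>' n\<close> passes every \<open>\<mu>\<^sub>k\<close>, an element common to all the ranges would exceed every \<open>k\<close>.
\<close>

lemma less_ord_succ: "\<alpha> < \<beta> \<Longrightarrow> \<alpha> < ord_succ \<alpha>"
  unfolding ord_succ_def by (rule LeastI)

lemma ord_succ_le: "\<alpha> < \<beta> \<Longrightarrow> ord_succ \<alpha> \<le> \<beta>"
  unfolding ord_succ_def by (rule Least_le)

lemma pos_increasing_pos: "pos_increasing g \<Longrightarrow> 1 \<le> x \<Longrightarrow> 1 \<le> g x"
  unfolding pos_increasing_def by auto

lemma pos_increasing_mono:
  assumes "pos_increasing g" "1 \<le> x" "x \<le> y"
  shows "g x \<le> g y"
  using assms unfolding pos_increasing_def strict_mono_on_def
  by (cases "x = y") (auto intro: less_imp_le)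

lemma pos_increasing_ge:
  assumes "pos_increasing g" "1 \<le> x"
  shows "x \<le> g x"
  using assms(2)
proof (induction x rule: nat_induct_at_least)
  case base
  then show ?case using pos_increasing_pos[OF assms(1)] by simp
next
  case (Suc n)
  then have "g n < g (Suc n)"
    using assms(1) unfolding pos_increasing_def strict_mono_on_def by auto
  with Suc.IH show ?case by simp
qed

text \<open>Strict growth keeps every \<open>s n\<close> below \<open>\<mu>\<close>. Any
  \<open>\<alpha> < \<mu>\<close> is passed by some \<open>s n\<close>, so its successor is at most
  \<open>s n\<close> and cannot be \<open>\<mu>\<close>.\<close>

lemma least_upper_bound_ord_limit:
  fixes s :: "nat \<Rightarrow> 'o::wellorder"
  assumes "strict_mono s" and ub: "\<And>n. s n \<le> \<mu>" and least: "\<And>u. (\<And>n. s n \<le> u) \<Longrightarrow> \<mu> \<le> u"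
  shows "ord_limit \<mu>"
proof -
  have less: "s n < \<mu>" for n
    using strict_monoD[OF assms(1), of n "Suc n"] ub[of "Suc n"] by simp
  have "\<mu> \<noteq> ord_zero"
    using less[of 0] unfolding ord_zero_def by (metis not_less_Least)
  moreover have "\<mu> \<noteq> ord_succ \<alpha>" if "\<alpha> < \<mu>" for \<alpha>
  proof -
    from that least obtain n where "\<alpha> < s n" by (meson not_le)
    with less[of n] ord_succ_le[of \<alpha> "s n"] show ?thesis by auto
  qed
  ultimately show ?thesis unfolding ord_limit_def by blast
qed

text \<open>The least index \<open>j\<close> with \<open>\<zeta> \<le> s j\<close> lies beyond
  \<open>m\<close>, so it has a predecessor \<open>k\<close>, which fails the inequality by
  minimality.\<close>

lemma strict_mono_bracket:
  fixes s :: "nat \<Rightarrow> 'o::linorder"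
  assumes "s m < \<zeta>" and "\<zeta> < s n" and "strict_mono s"
  obtains k where "m \<le> k" "s k < \<zeta>" "\<zeta> \<le> s (Suc k)"
proof -
  define j where "j = (LEAST i. \<zeta> \<le> s i)"
  have j: "\<zeta> \<le> s j"
    unfolding j_def using assms(2) by (rule LeastI[OF less_imp_le])
  with assms(1) have "s m < s j" by simp
  then have "m < j" using assms(3) strict_mono_less by blast
  then obtain k where k: "j = Suc k" "m \<le> k" by (cases j) auto
  then have "\<not> \<zeta> \<le> s k" using not_less_Least[of k "\<lambda>i. \<zeta> \<le> s i"] unfolding j_def by simp
  with j k show ?thesis by (intro that) auto
qed

theorem theorem1:
  fixes \<Lambda> :: "'o::wellorder"
    and f :: "'o \<Rightarrow> nat \<Rightarrow> nat"
    and fs :: "'o \<Rightarrow> nat \<Rightarrow> 'o"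
    and \<eta>' :: "nat \<Rightarrow> 'o"
  assumes "ord_limit \<Lambda>" and "le_Omega \<Lambda>"
    and "\<forall>\<eta><\<Lambda>. pos_increasing (f \<eta>)"
    and "\<forall>x\<ge>1. f ord_zero x = 2 ^ x"
    and "\<forall>\<eta><\<Lambda>. \<forall>\<xi><\<eta>. \<eta> = ord_succ \<xi> \<longrightarrow> (\<forall>x\<ge>1. f \<eta> x = (f \<xi> \<circ> f \<xi>) x)"
    and "\<forall>\<eta><\<Lambda>. ord_limit \<eta> \<longrightarrow>
           strict_mono (fs \<eta>) \<and> isLub UNIV (range (fs \<eta>)) \<eta> \<and>
           (\<forall>x. arrow f \<Lambda> (ord_succ (fs \<eta> x)) (fs \<eta> (Suc x))) \<and>
           (\<forall>x\<ge>1. f \<eta> x = f (fs \<eta> x) 1)"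
    and "strict_mono \<eta>'" and "\<forall>n. \<eta>' n < \<Lambda>"
    and "\<not> isLub UNIV (range \<eta>') \<Lambda>"
  shows "(\<Inter>n. V (f (\<eta>' n))) = {}"
proof (rule ccontr)
  note pos = assms(3) and succ = assms(5) and lim = assms(6)
  assume "(\<Inter>n. V (f (\<eta>' n))) \<noteq> {}"
  then obtain y where y: "\<And>n. y \<in> V (f (\<eta>' n))" by blast
  \<comment> \<open>\<open>\<Lambda>\<close> is an upper bound, so only its leastness can fail: this
    yields a bound \<open>u\<close> below \<open>\<Lambda>\<close>.\<close>
  have "isUb UNIV (range \<eta>') \<Lambda>"
    using assms(8) by (auto simp: isUb_def setle_def intro: less_imp_le)
  with assms(9) obtain u where "isUb UNIV (range \<eta>') u" "\<not> \<Lambda> \<le> u"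
    unfolding isLub_def leastP_def setge_def by blast
  then have u: "\<And>n. \<eta>' n \<le> u" "u < \<Lambda>"
    by (auto simp: isUb_def setle_def)
  \<comment> \<open>The bound \<open>u\<close> shows that this minimum exists and lies below
    \<open>\<Lambda>\<close>, where the limit clause applies.\<close>
  define \<mu> where "\<mu> = (LEAST u. \<forall>n. \<eta>' n \<le> u)"
  have \<mu>_ub: "\<eta>' n \<le> \<mu>" for n
    using LeastI[of "\<lambda>u. \<forall>n. \<eta>' n \<le> u" u] u(1) unfolding \<mu>_def by blast
  have \<mu>_least: "\<mu> \<le> v" if "\<And>n. \<eta>' n \<le> v" for v
    unfolding \<mu>_def using that by (simp add: Least_le)
  have "\<mu> < \<Lambda>" using \<mu>_least[OF u(1)] u(2) by simp
  have "ord_limit \<mu>"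
    using least_upper_bound_ord_limit[OF assms(7) \<mu>_ub \<mu>_least] .
  with lim[rule_format, OF \<open>\<mu> < \<Lambda>\<close>] have mono: "strict_mono (fs \<mu>)"
    and lub: "isLub UNIV (range (fs \<mu>)) \<mu>"
    and arr: "\<And>x. arrow f \<Lambda> (ord_succ (fs \<mu> x)) (fs \<mu> (Suc x))"
    and f\<mu>: "\<And>x. 1 \<le> x \<Longrightarrow> f \<mu> x = f (fs \<mu> x) 1"
    by auto
  have fs_le: "fs \<mu> x \<le> \<mu>" for x
    using isLubD2[OF lub] by blast
  have fs_less: "fs \<mu> x < \<mu>" for x
    using strict_monoD[OF mono, of x "Suc x"] fs_le[of "Suc x"] by simp
  have \<eta>'_less: "\<eta>' n < \<mu>" for n
    using strict_monoD[OF assms(7), of n "Suc n"] \<mu>_ub[of "Suc n"] by simp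

  \<comment> \<open>Assuming \<open>1 \<le> x\<close> makes the bracketing index
    \<open>k \<ge> x\<close> positive, as the formula for \<open>f \<mu> k\<close> requires.\<close>
  have "x \<le> y" if "1 \<le> x" for x
  proof -
    obtain n where "fs \<mu> x < \<eta>' n"
      using \<mu>_least[of "fs \<mu> x"] fs_less[of x] by (meson not_le)
    moreover have "\<not> isUb UNIV (range (fs \<mu>)) (\<eta>' n)"
      using isLub_le_isUb[OF lub, of "\<eta>' n"] \<eta>'_less[of n] by auto
    then obtain m where "\<eta>' n < fs \<mu> m"
      by (auto simp: isUb_def setle_def not_le)
    ultimately obtain k where k: "x \<le> k" "fs \<mu> k < \<eta>' n" "\<eta>' n \<le> fs \<mu> (Suc k)"
      using strict_mono_bracket[OF _ _ mono] by blast
    let ?\<sigma> = "ord_succ (fs \<mu> k)"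
    have "fs \<mu> k < ?\<sigma>" "?\<sigma> \<le> \<eta>' n"
      using k(2) by (rule less_ord_succ, rule ord_succ_le)
    moreover from this have "?\<sigma> < \<Lambda>" using assms(8) le_less_trans by blast
    \<comment> \<open>The arrow speaks only of indices strictly above \<open>?\<sigma>\<close>; at
      \<open>?\<sigma>\<close> itself the inclusion is trivial.\<close>
    moreover from calculation have "V (f (\<eta>' n)) \<subseteq> V (f ?\<sigma>)"
      using arr[of k] k(3) unfolding arrow_def by (cases "?\<sigma> = \<eta>' n") auto
    with y obtain z where z: "1 \<le> z" "y = f ?\<sigma> z" unfolding V_def by blast
    ultimately have yz: "y = f (fs \<mu> k) (f (fs \<mu> k) z)" using succ by auto
    have g: "pos_increasing (f (fs \<mu> k))"
      using pos fs_less[of k] \<open>\<mu> < \<Lambda>\<close> by (meson less_trans)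
    \<comment> \<open>The inner value \<open>f (fs \<mu> k) z\<close> is already at least
      \<open>k\<close>; the outer application does not decrease it.\<close>
    have "k \<le> f \<mu> k" using pos_increasing_ge pos \<open>\<mu> < \<Lambda>\<close> k(1) that by simp
    also have "\<dots> = f (fs \<mu> k) 1" using f\<mu> k(1) that by simp
    also have "\<dots> \<le> f (fs \<mu> k) z" using pos_increasing_mono[OF g] z(1) by simp
    also have "\<dots> \<le> y"
      unfolding yz using pos_increasing_ge[OF g] pos_increasing_pos[OF g z(1)] by simp
    finally show ?thesis using k(1) by simp
  qed
  from this[of "Suc y"] show False by simp
qed

end
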